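(* Let $\mathbb{K}$ be a field of characteristic zero, $q\in\mathbb{K}\setminus\{0\}$ not a root of unity, and $\tau_x,\tau_y$ the $q$-shift operators on $\mathbb{K}(x,y)$ given by $\tau_x h(x,y)=h(qx,y)$ and $\tau_y h(x,y)=h(x,qy)$. Let $a\in\mathbb{K}[x,y]\setminus\{0\}$, $b\in\mathbb{K}[x]\setminus\{0\}$, let $m$ be a positive integer, $j$ a positive integer and $n,v\in\mathbb{Z}$. Let $(A(x),B(x),C(x))$ be an $m$-fold $q$-Gosper representation of $\frac{b(x)}{b(xq^m)}$, i.e. $A,B,C\in\mathbb{K}[x]$ are polynomials with \[ \frac{b(x)}{b(xq^m)}=\frac{A(x)}{B(x)}\cdot\frac{C(xq^m)}{C(x)}\quad\text{and}\quad \gcd\big(A(x),B(xq^{hm})\big)=1\ \text{ for all } h\in\mathbb{N}. \] Then every solution $p(x,y)\in\mathbb{K}(x)[y]$ of the $q$-difference equation \[ \frac{a}{b}=q^{-vj}\tau_x^m\tau_y^{-n}(p)-p \] is of the form \[ p(x,y)=\frac{B(xq^{-m})\,\hat{p}(x,y)}{b(x)\,C(x)} \] for some $\hat{p}(x,y)\in\mathbb{K}[x,x^{-1},y]$.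
   Context: $\mathbb{N}=\{0,1,2,\dots\}$. $\mathbb{K}[x,x^{-1},y]$ denotes the ring of polynomials in $y$ whose coefficients are Laurent polynomials in $x$. *)

theory Defs
  imports "HOL-Computational_Algebra.Computational_Algebra"
begin

text \<open>
  For a field \<^typ>\<open>'a\<close> of constants, \<open>K(x)\<close> is \<^typ>\<open>'a poly fract\<close>, \<open>K(x)[y]\<close> is
  \<^typ>\<open>'a poly fract poly\<close>, and \<open>K(x,y)\<close> is realised as \<open>K(x)(y)\<close>, the field of fractions
  of \<open>K(x)[y]\<close>. In \<open>K[x,y]\<close>, i.e. \<^typ>\<open>'a poly poly\<close>, the outer variable is \<open>y\<close>.
\<close>

type_synonym 'a ratfun_x = "'a poly fract"
type_synonym 'a ratfun_xy = "'a poly fract poly fract"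

definition emb_x :: "'a::field poly \<Rightarrow> 'a ratfun_xy" where
  "emb_x f = to_fract [:to_fract f:]"

definition emb_xy :: "'a::field poly poly \<Rightarrow> 'a ratfun_xy" where
  "emb_xy f = to_fract (map_poly to_fract f)"

definition emb_const :: "'a::field \<Rightarrow> 'a ratfun_xy" where
  "emb_const c = emb_x [:c:]"


text \<open>\<open>dilate c f\<close> is \<open>f(c t)\<close>, where \<open>t\<close> is the (outer) variable of \<open>f\<close>.\<close>

definition dilate :: "'a::comm_ring_1 \<Rightarrow> 'a poly \<Rightarrow> 'a poly" where
  "dilate c f = f \<circ>\<^sub>p [:0, c:]"

text \<open>
  The extension of an injective ring homomorphism \<open>f\<close> to the fields of fractions. It is defined
  by choosing a representative; lemma \<open>map_fract_Fract\<close> below shows that the choice is irrelevant.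
\<close>

definition map_fract :: "('a::idom \<Rightarrow> 'b::idom) \<Rightarrow> 'a fract \<Rightarrow> 'b fract" where
  "map_fract f r = (case (SOME (u, w). w \<noteq> 0 \<and> r = Fract u w) of (u, w) \<Rightarrow> Fract (f u) (f w))"

definition tau_x :: "'a::field \<Rightarrow> 'a ratfun_xy \<Rightarrow> 'a ratfun_xy" where
  "tau_x q = map_fract (map_poly (map_fract (dilate q)))"

definition tau_y :: "'a::field \<Rightarrow> 'a ratfun_xy \<Rightarrow> 'a ratfun_xy" where
  "tau_y q = map_fract (dilate (to_fract [:q:]))"

text \<open>Integer powers of an operator; meaningful for negative \<open>k\<close> only if \<open>f\<close> is bijective.\<close>

definition int_iter :: "('a \<Rightarrow> 'a) \<Rightarrow> int \<Rightarrow> 'a \<Rightarrow> 'a" where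
  "int_iter f k = (if k \<ge> 0 then f ^^ nat k else inv f ^^ nat (- k))"


definition q_gosper_rep ::
    "'a::field \<Rightarrow> nat \<Rightarrow> 'a ratfun_x \<Rightarrow> 'a poly \<Rightarrow> 'a poly \<Rightarrow> 'a poly \<Rightarrow> bool" where
  "q_gosper_rep q m r A B C \<longleftrightarrow>
     B \<noteq> 0 \<and> C \<noteq> 0 \<and>
     r = (to_fract A / to_fract B) * (to_fract (dilate (q ^ m) C) / to_fract C) \<and>
     (\<forall>h. coprime A (dilate (q ^ (h * m)) B))"

definition laurent_polys :: "'a::field ratfun_x set" where
  "laurent_polys = {(\<Sum>i\<in>I. to_fract [:c i:] * to_fract [:0, 1:] powi i) |c I. finite (I :: int set)}"

text \<open>\<open>K[x,x\<^sup>-\<^sup>1,y]\<close> as a subset of \<open>K(x)[y]\<close>\<close>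

definition laurent_polys_y :: "'a::field ratfun_x poly set" where
  "laurent_polys_y = {f. \<forall>i. coeff f i \<in> laurent_polys}"


subsection \<open>Well-definedness of the shift operators\<close>

definition inj_ring_hom :: "('a::comm_ring_1 \<Rightarrow> 'b::comm_ring_1) \<Rightarrow> bool" where
  "inj_ring_hom f \<longleftrightarrow> (\<forall>u w. f (u + w) = f u + f w) \<and> (\<forall>u w. f (u * w) = f u * f w) \<and>
     f 1 = 1 \<and> inj f"

lemma inj_ring_hom_0: "inj_ring_hom f \<Longrightarrow> f 0 = 0"
  unfolding inj_ring_hom_def by (metis add_cancel_right_right)

lemma inj_ring_hom_eq_0_iff: "inj_ring_hom f \<Longrightarrow> f u = 0 \<longleftrightarrow> u = 0"
  using inj_ring_hom_0[of f] unfolding inj_ring_hom_def by (metis injD)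

lemma map_fract_Fract:
  assumes f: "inj_ring_hom f" and w: "w \<noteq> 0"
  shows "map_fract f (Fract u w) = Fract (f u) (f w)"
proof -
  let ?P = "\<lambda>(u', w'). w' \<noteq> 0 \<and> Fract u w = Fract u' w'"
  obtain u' w' where uw: "(SOME z. ?P z) = (u', w')" by (cases "SOME z. ?P z")
  have "?P (u', w')" unfolding uw[symmetric] by (rule someI[of ?P "(u, w)"]) (simp add: w)
  hence w': "w' \<noteq> 0" and "u * w' = u' * w" using w by (auto simp: eq_fract)
  hence "f u * f w' = f u' * f w" using f unfolding inj_ring_hom_def by metis
  moreover have "f w \<noteq> 0" "f w' \<noteq> 0" using f w w' by (simp_all add: inj_ring_hom_eq_0_iff)
  ultimately show ?thesis unfolding map_fract_def uw by (simp add: eq_fract)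
qed

lemma map_fract_to_fract: "inj_ring_hom f \<Longrightarrow> map_fract f (to_fract u) = to_fract (f u)"
  by (simp add: to_fract_def map_fract_Fract) (simp add: inj_ring_hom_def)

lemma inj_ring_hom_map_fract:
  assumes f: "inj_ring_hom f"
  shows "inj_ring_hom (map_fract f)"
proof -
  have nz: "f w \<noteq> 0" if "w \<noteq> 0" for w using that f by (simp add: inj_ring_hom_eq_0_iff)
  have hom: "f (u + w) = f u + f w" "f (u * w) = f u * f w" for u w
    using f by (auto simp: inj_ring_hom_def)
  have "map_fract f (r + s) = map_fract f r + map_fract f s" for r s
    by (cases r rule: Fract_cases, cases s rule: Fract_cases)
       (simp add: map_fract_Fract[OF f] nz hom)
  moreover have "map_fract f (r * s) = map_fract f r * map_fract f s" for r s
    by (cases r rule: Fract_cases, cases s rule: Fract_cases)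
       (simp add: map_fract_Fract[OF f] nz hom)
  moreover have "map_fract f 1 = 1"
    using map_fract_to_fract[OF f, of 1] f by (simp add: inj_ring_hom_def)
  moreover have "r = s" if "map_fract f r = map_fract f s" for r s
  proof -
    obtain u w u' w' where rs: "r = Fract u w" "s = Fract u' w'" "w \<noteq> 0" "w' \<noteq> 0"
      by (metis Fract_cases)
    with that have "f u * f w' = f u' * f w" by (simp add: map_fract_Fract[OF f] eq_fract nz)
    hence "f (u * w') = f (u' * w)" by (simp only: hom)
    hence "u * w' = u' * w" using f unfolding inj_ring_hom_def by (metis injD)
    thus ?thesis using rs by (simp add: eq_fract)
  qed
  ultimately show ?thesis by (auto simp: inj_ring_hom_def inj_def)
qed

lemma inj_ring_hom_map_poly:
  assumes f: "inj_ring_hom f"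
  shows "inj_ring_hom (map_poly f)"
proof -
  have f0: "f 0 = 0" by (rule inj_ring_hom_0[OF f])
  have hom: "f (u + w) = f u + f w" "f (u * w) = f u * f w" "f 1 = 1" for u w
    using f by (auto simp: inj_ring_hom_def)
  have sum: "f (sum g S) = (\<Sum>i\<in>S. f (g i))" for g :: "nat \<Rightarrow> _" and S
    by (induction S rule: infinite_finite_induct) (simp_all add: f0 hom)
  have "map_poly f (P + Q) = map_poly f P + map_poly f Q" for P Q
    by (rule poly_eqI) (simp add: coeff_map_poly f0 hom)
  moreover have "map_poly f (P * Q) = map_poly f P * map_poly f Q" for P Q
    by (rule poly_eqI) (simp add: coeff_map_poly f0 hom coeff_mult sum)
  moreover have "P = Q" if "map_poly f P = map_poly f Q" for P Q
  proof (rule poly_eqI)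
    fix i
    have "f (coeff P i) = f (coeff Q i)"
      using arg_cong[OF that, of "\<lambda>g. coeff g i"] by (simp add: coeff_map_poly f0)
    thus "coeff P i = coeff Q i" using f by (auto simp: inj_ring_hom_def dest: injD)
  qed
  ultimately show ?thesis by (auto simp: inj_ring_hom_def inj_def f0 hom)
qed

lemma coeff_dilate: "coeff (dilate c f) i = c ^ i * coeff f i"
  unfolding dilate_def by (rule coeff_pcompose_linear)

lemma dilate_dilate: "dilate c (dilate d f) = dilate (c * d) f"
  by (rule poly_eqI) (simp add: coeff_dilate power_mult_distrib)

lemma dilate_1 [simp]: "dilate 1 f = f"
  by (rule poly_eqI) (simp add: coeff_dilate)

lemma inj_ring_hom_dilate:
  assumes "(c :: 'a::idom) \<noteq> 0"
  shows "inj_ring_hom (dilate c)"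
proof -
  have "f = g" if "dilate c f = dilate c g" for f g
    by (rule poly_eqI) (use arg_cong[OF that, of "\<lambda>h. coeff h i" for i] assms in
      \<open>simp add: coeff_dilate\<close>)
  thus ?thesis
    by (auto simp: inj_ring_hom_def inj_def dilate_def pcompose_add pcompose_mult pcompose_1)
qed

lemma inj_ring_hom_tau_x: "q \<noteq> 0 \<Longrightarrow> inj_ring_hom (tau_x q)"
  unfolding tau_x_def
  by (intro inj_ring_hom_map_fract inj_ring_hom_map_poly inj_ring_hom_dilate)

lemma inj_ring_hom_tau_y: "q \<noteq> 0 \<Longrightarrow> inj_ring_hom (tau_y q)"
  unfolding tau_y_def by (intro inj_ring_hom_map_fract inj_ring_hom_dilate) simp

lemma tau_x_to_fract:
  "q \<noteq> 0 \<Longrightarrow> tau_x q (to_fract f) = to_fract (map_poly (map_fract (dilate q)) f)"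
  unfolding tau_x_def
  by (intro map_fract_to_fract inj_ring_hom_map_poly inj_ring_hom_map_fract inj_ring_hom_dilate)

lemma tau_y_to_fract: "q \<noteq> 0 \<Longrightarrow> tau_y q (to_fract f) = to_fract (dilate (to_fract [:q:]) f)"
  unfolding tau_y_def by (intro map_fract_to_fract inj_ring_hom_dilate) simp

lemma tau_x_emb_xy:
  assumes "q \<noteq> 0"
  shows "tau_x q (emb_xy f) = emb_xy (map_poly (dilate q) f)"
proof -
  have *: "inj_ring_hom (dilate q)" using assms by (rule inj_ring_hom_dilate)
  note zero = inj_ring_hom_0[OF *] inj_ring_hom_0[OF inj_ring_hom_map_fract[OF *]]
  show ?thesis unfolding emb_xy_def tau_x_to_fract[OF assms]
    by (intro arg_cong[of _ _ to_fract] poly_eqI)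
       (simp add: coeff_map_poly zero map_fract_to_fract[OF *])
qed

lemma tau_y_emb_xy:
  assumes "q \<noteq> 0"
  shows "tau_y q (emb_xy f) = emb_xy (dilate [:q:] f)"
proof -
  have "to_fract (u ^ i) = to_fract u ^ i" for u :: "'a poly" and i
    by (induction i) simp_all
  thus ?thesis unfolding emb_xy_def tau_y_to_fract[OF assms]
    by (intro arg_cong[of _ _ to_fract] poly_eqI) (simp add: coeff_map_poly coeff_dilate)
qed

lemma tau_y_tau_y:
  assumes "c \<noteq> 0" "d \<noteq> 0"
  shows "tau_y c (tau_y d r) = tau_y (c * d) r"
proof -
  let ?D = "\<lambda>c. dilate (to_fract [:c:] :: 'a poly fract)"
  have D: "inj_ring_hom (?D c)" if "c \<noteq> 0" for c :: 'a
    using that by (intro inj_ring_hom_dilate) simp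
  obtain u w where r: "r = Fract u w" "w \<noteq> 0" by (metis Fract_cases)
  have "?D d w \<noteq> 0" using D[OF assms(2)] r(2) by (simp add: inj_ring_hom_eq_0_iff)
  thus ?thesis using assms r(2) unfolding tau_y_def r(1)
    by (simp add: map_fract_Fract D dilate_dilate mult.commute flip: to_fract_mult)
qed

lemma tau_y_1: "tau_y 1 r = (r :: 'a::field ratfun_xy)"
proof -
  have one: "to_fract [:1 :: 'a:] = 1" by (simp flip: one_pCons)
  obtain u w where r: "r = Fract u w" "w \<noteq> 0" by (metis Fract_cases)
  thus ?thesis unfolding tau_y_def one
    by (simp add: map_fract_Fract inj_ring_hom_dilate)
qed

lemma inv_tau_y:
  assumes "q \<noteq> 0"
  shows "inv (tau_y q) = tau_y (inverse q)"
  by (rule inv_equality) (use assms in \<open>simp_all add: tau_y_tau_y tau_y_1\<close>)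

lemma int_iter_tau_y:
  assumes "q \<noteq> 0"
  shows "int_iter (tau_y q) k = tau_y (q powi k)"
proof -
  have "tau_y c ^^ i = tau_y (c ^ i)" if "c \<noteq> 0" for c :: 'a and i
    using that by (induction i) (auto simp: tau_y_1 tau_y_tau_y)
  thus ?thesis using assms by (auto simp: int_iter_def power_int_def inv_tau_y)
qed

end

theory Submission
  imports Defs
begin

text \<open>
  Comparing coefficients of powers of \<open>y\<close> reduces the claim to one unknown \<open>r \<in> K(x)\<close>, and
  the substitution \<open>r = B(x Q\<^sup>-\<^sup>1) f / (b C)\<close>, \<open>Q = q\<^sup>m\<close>, turns the equation into
  \<open>e C = \<alpha> A(x) f(Q x) - B(x Q\<^sup>-\<^sup>1) f(x)\<close> with \<open>e\<close> a polynomial. Let \<open>f = u / w\<close> in lowest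
  terms and suppose that an irreducible \<open>P\<close> with \<open>P(0) \<noteq> 0\<close> divides \<open>w\<close>. The dilates \<open>P(Q\<^sup>k x)\<close>
  are pairwise non-associated, so only finitely many of them divide \<open>w\<close>; let \<open>k\<^sub>1 \<le> k\<^sub>2\<close> be the
  least and the greatest such exponent. Then \<open>P(Q\<^bsup>k\<^sub>1\<^esup> x)\<close> divides \<open>B(x Q\<^sup>-\<^sup>1)\<close>
  and \<open>P(Q\<^bsup>k\<^sub>2 + 1\<^esup> x)\<close> divides \<open>A\<close>, so \<open>A\<close> and \<open>B(Q\<^bsup>k\<^sub>2 - k\<^sub>1\<^esup> x)\<close> are not coprime, a
  contradiction. Hence \<open>w\<close> is a monomial.
\<close>

subsection \<open>Dilations of polynomials\<close>

lemma dilate_mult: "dilate c (f * g) = dilate c f * dilate c g"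
  by (simp add: dilate_def pcompose_mult)

lemma dilate_dvd: "f dvd g \<Longrightarrow> dilate c f dvd dilate c g"
  by (auto simp: dvd_def dilate_mult)

lemma dilate_inverse_cancel:
  fixes c :: "'a::field"
  assumes "c \<noteq> 0"
  shows "dilate c (dilate (inverse c) f) = f" "dilate (inverse c) (dilate c f) = f"
  using assms by (simp_all add: dilate_dilate)

lemma dilate_dvd_iff:
  fixes c :: "'a::field"
  assumes "c \<noteq> 0"
  shows "dilate c f dvd dilate c g \<longleftrightarrow> f dvd g"
  by (metis assms dilate_dvd dilate_inverse_cancel(2))

lemma dilate_eq_0_iff: "c \<noteq> 0 \<Longrightarrow> dilate c f = 0 \<longleftrightarrow> f = 0" for c :: "'a::idom"
  by (rule inj_ring_hom_eq_0_iff[OF inj_ring_hom_dilate])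

lemma degree_dilate: "c \<noteq> 0 \<Longrightarrow> degree (dilate c f) = degree f" for c :: "'a::idom"
  by (simp add: dilate_def degree_pcompose)

lemma irreducible_dilate:
  fixes c :: "'a::field"
  assumes c: "c \<noteq> 0" and f: "irreducible f"
  shows "irreducible (dilate c f)"
proof (rule irreducibleI)
  show "dilate c f \<noteq> 0" using f c by (auto simp: dilate_eq_0_iff)
  have one: "dilate d 1 = (1 :: 'a poly)" for d by (simp add: dilate_def pcompose_1)
  show "\<not> dilate c f dvd 1"
    using dilate_dvd_iff[OF c, of f 1] irreducible_not_unit[OF f] by (simp add: one)
  fix a b assume "dilate c f = a * b"
  hence "f = dilate (inverse c) a * dilate (inverse c) b"
    by (metis c dilate_inverse_cancel(2) dilate_mult)
  with f have "dilate (inverse c) a dvd 1 \<or> dilate (inverse c) b dvd 1"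
    by (rule irreducibleD)
  thus "a dvd 1 \<or> b dvd 1"
    by (metis c dilate_dvd dilate_inverse_cancel(1) one)
qed

lemma irreducible_dvd_imp_associated:
  fixes p :: "'a::field poly"
  assumes "irreducible p" "irreducible r" "p dvd r"
  shows "\<exists>c. r = smult c p"
proof -
  obtain s where s: "r = p * s" using assms(3) by (elim dvdE)
  hence "s dvd 1" using assms irreducibleD irreducible_not_unit by blast
  then obtain c where "s = [:c:]" by (auto simp: is_unit_poly_iff)
  thus ?thesis using s by auto
qed

text \<open>Comparing constant and leading coefficients.\<close>

lemma dilate_not_associated:
  fixes Q :: "'a::field"
  assumes Q: "Q \<noteq> 0" "\<forall>k::nat. k > 0 \<longrightarrow> Q ^ k \<noteq> 1"
    and p: "irreducible p" "coeff p 0 \<noteq> 0" and kl: "k \<noteq> l"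
  shows "\<not> dilate (Q powi k) p dvd dilate (Q powi l) p"
proof
  assume "dilate (Q powi k) p dvd dilate (Q powi l) p"
  then obtain c where c: "dilate (Q powi l) p = smult c (dilate (Q powi k) p)"
    using irreducible_dvd_imp_associated irreducible_dilate p Q(1) by (metis power_int_not_zero)
  have "coeff p 0 = c * coeff p 0"
    using arg_cong[OF c, of "\<lambda>h. coeff h 0"] by (simp add: coeff_dilate)
  hence c1: "c = 1" using p(2) by simp
  define d where "d = degree p"
  have "p \<noteq> 0" using p by auto
  have "d > 0" unfolding d_def
    using p(1) \<open>p \<noteq> 0\<close> irreducible_not_unit is_unit_iff_degree by blast
  have "(Q powi l) ^ d * coeff p d = (Q powi k) ^ d * coeff p d"
    using arg_cong[OF c, of "\<lambda>h. coeff h d"] by (simp add: coeff_dilate c1)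
  hence "(Q powi l) ^ d = (Q powi k) ^ d" using \<open>p \<noteq> 0\<close> by (simp add: d_def)
  hence eq: "Q powi (l * int d) = Q powi (k * int d)" by (simp add: power_int_mult)
  \<comment> \<open>The hypothesis on \<open>Q\<close> concerns positive powers only, so the
    exponents are taken in order; the conclusion uses both orders of \<open>l * int d\<close> and
    \<open>k * int d\<close>.\<close>
  have key: "False" if "Q powi s = Q powi t" "s < t" for s t
  proof -
    have "Q powi (t - s) = 1" using that Q(1) by (simp add: power_int_diff)
    hence "Q ^ nat (t - s) = 1" using that by (simp add: power_int_def split: if_splits)
    thus False using Q(2) that by simp
  qed
  have "l * int d \<noteq> k * int d" using kl \<open>d > 0\<close> by simp
  thus False using key[OF eq] key[OF eq[symmetric]] by linarith
qed

text \<open>Irreducible polynomials over a field are prime. By induction, a new factor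
  \<open>g s\<close> divides none of the earlier ones, so it must divide the cofactor of their
  product in \<open>w\<close>.\<close>

lemma prod_irreducible_dvd:
  fixes g :: "'i \<Rightarrow> 'a::field poly"
  assumes "finite S" "\<And>i. i \<in> S \<Longrightarrow> irreducible (g i)" "\<And>i. i \<in> S \<Longrightarrow> g i dvd w"
    and "\<And>i k. i \<in> S \<Longrightarrow> k \<in> S \<Longrightarrow> i \<noteq> k \<Longrightarrow> \<not> g i dvd g k"
  shows "prod g S dvd w"
  using assms
proof (induction S rule: finite_induct)
  case (insert s S)
  then obtain t where t: "w = prod g S * t" by (auto elim!: dvdE)
  have pr: "prime_elem (g s)" using insert.prems by (intro field_poly_irreducible_imp_prime) auto
  have sS: "\<not> g s dvd g i" if "i \<in> S" for i
    using insert.prems(3)[of s i] insert.hyps(2) that by auto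
  have "\<not> g s dvd prod g S'" if "finite S'" "S' \<subseteq> S" for S'
    using that
  proof (induction S' rule: finite_induct)
    case empty
    then show ?case using pr by (simp add: prime_elem_def)
  next
    case (insert z Z)
    thus ?case using pr sS by (simp add: prime_elem_dvd_mult_iff)
  qed
  hence "\<not> g s dvd prod g S" using insert.hyps by simp
  moreover have "g s dvd prod g S * t" using insert.prems t by auto
  ultimately have "g s dvd t" using pr by (simp add: prime_elem_dvd_mult_iff)
  thus ?case using insert.hyps t by (simp add: mult.commute mult_dvd_mono)
qed auto

text \<open>The product of any finite set of such dilates divides \<open>w\<close>, and each of them
  has the positive degree of \<open>p\<close>; hence there are at most \<open>degree w\<close> of
  them.\<close>

lemma finite_dilates_dvd:
  fixes Q :: "'a::field"
  assumes Q: "Q \<noteq> 0" "\<forall>k::nat. k > 0 \<longrightarrow> Q ^ k \<noteq> 1"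
    and p: "irreducible p" "coeff p 0 \<noteq> 0" and w: "w \<noteq> 0"
  shows "finite {k::int. dilate (Q powi k) p dvd w}" (is "finite ?D")
proof (rule ccontr)
  assume "infinite ?D"
  then obtain S where S: "S \<subseteq> ?D" "finite S" "card S = Suc (degree w)"
    using infinite_arbitrarily_large by blast
  have Qk: "Q powi k \<noteq> 0" for k using Q(1) by simp
  have "prod (\<lambda>k. dilate (Q powi k) p) S dvd w"
    using S dilate_not_associated[OF Q p] irreducible_dilate[OF Qk p(1)]
    by (intro prod_irreducible_dvd) auto
  hence "degree (prod (\<lambda>k. dilate (Q powi k) p) S) \<le> degree w" using w by (rule dvd_imp_degree_le)
  moreover have "degree (prod (\<lambda>k. dilate (Q powi k) p) S) = card S * degree p"
    using p(1) by (subst degree_prod_eq_sum_degree)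
      (auto simp: dilate_eq_0_iff[OF Qk] degree_dilate[OF Qk])
  moreover have "degree p > 0"
    using p irreducible_not_unit is_unit_iff_degree by (metis not_gr_zero not_irreducible_zero)
  ultimately show False using S(3)
    by (metis Suc_n_not_le_n le_trans mult_le_mono2 nat_mult_1_right Suc_leI One_nat_def)
qed

subsection \<open>The denominator of a rational solution\<close>

text \<open>For \<open>f = u / w\<close>, \<open>eq\<close> is
  \<open>e = \<alpha> A f(Q x) - B(x / Q) f\<close> with the denominators cleared, and
  \<open>low\<close> says that \<open>u / w\<close> is in lowest terms.\<close>

lemma q_gosper_denominator:
  fixes Q \<alpha> :: "'a::field"
  assumes Q: "Q \<noteq> 0" "\<forall>k::nat. k > 0 \<longrightarrow> Q ^ k \<noteq> 1" and \<alpha>: "\<alpha> \<noteq> 0" and w: "w \<noteq> 0"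
    and cop: "\<And>h. coprime A (dilate (Q ^ h) B)"
    and low: "\<And>s. irreducible s \<Longrightarrow> s dvd w \<Longrightarrow> \<not> s dvd u"
    and eq: "smult \<alpha> (A * dilate Q u * w) - dilate (inverse Q) B * u * dilate Q w =
               e * w * dilate Q w"
    and p: "irreducible p" "p dvd w"
  shows "coeff p 0 = 0"
proof (rule ccontr)
  assume p0: "coeff p 0 \<noteq> 0"
  define P where "P = (\<lambda>k::int. dilate (Q powi k) p)"
  define D where "D = {k. P k dvd w}"
  have irr: "irreducible (P k)" for k
    unfolding P_def by (rule irreducible_dilate) (use p(1) Q(1) in auto)
  have pr: "prime_elem (P k)" for k using irr by (rule field_poly_irreducible_imp_prime)
  have shift: "dilate (Q powi k) (P l) = P (k + l)" for k l
    using Q(1) by (simp add: P_def dilate_dilate power_int_add)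
  have up: "dilate Q (P l) = P (l + 1)" for l using shift[of 1 l] by (simp add: add.commute)
  have "finite D" unfolding D_def P_def using finite_dilates_dvd[OF Q p(1) p0 w] .
  moreover have "0 \<in> D" using p by (simp add: D_def P_def)
  ultimately have D: "Min D \<in> D" "Max D \<in> D" "Min D \<le> Max D"
    "\<And>k. k \<in> D \<Longrightarrow> Min D \<le> k" "\<And>k. k \<in> D \<Longrightarrow> k \<le> Max D"
    by (auto intro: Min_in Max_in order_trans[OF Min_le Max_ge])
  define k l where "k = Min D" and "l = Max D"
  have dvd_dilate: "P (i + 1) dvd dilate Q g \<longleftrightarrow> P i dvd g" for i g
    using dilate_dvd_iff[OF Q(1), of "P i" g] by (simp add: up)
  have "P k dvd w" "\<not> P (k - 1) dvd w" "P l dvd w" "\<not> P (l + 1) dvd w"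
    using D D(4)[of "k - 1"] D(5)[of "l + 1"] by (auto simp: D_def k_def l_def)
  \<comment> \<open>The other two terms of \<open>eq\<close> contain the factor
    \<open>w\<close>.\<close>
  have "P k dvd dilate (inverse Q) B * u * dilate Q w"
  proof -
    have "dilate (inverse Q) B * u * dilate Q w =
            w * (smult \<alpha> (A * dilate Q u) - e * dilate Q w)"
      using eq by (simp add: algebra_simps)
    thus ?thesis using \<open>P k dvd w\<close> by simp
  qed
  \<comment> \<open>Lowest terms exclude \<open>u\<close>. Minimality of \<open>k\<close> excludes
    \<open>dilate Q w\<close>, which would put \<open>P (k - 1)\<close> into
    \<open>w\<close>.\<close>
  hence B: "P k dvd dilate (inverse Q) B"
    using pr low[OF irr \<open>P k dvd w\<close>] \<open>\<not> P (k - 1) dvd w\<close> dvd_dilate[of "k - 1" w]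
    by (simp add: prime_elem_dvd_mult_iff)
  \<comment> \<open>Here the other two terms contain \<open>dilate Q w\<close>, which
    \<open>P (l + 1)\<close> divides. Afterwards maximality of \<open>l\<close> excludes
    \<open>w\<close>, and lowest terms exclude \<open>dilate Q u\<close>.\<close>
  have "P (l + 1) dvd smult \<alpha> (A * dilate Q u * w)"
  proof -
    have "smult \<alpha> (A * dilate Q u * w) = dilate Q w * (e * w + dilate (inverse Q) B * u)"
      using eq by (simp add: algebra_simps)
    thus ?thesis using \<open>P l dvd w\<close> by (simp add: dvd_dilate)
  qed
  hence "P (l + 1) dvd A * dilate Q u * w" using \<alpha> by (simp add: dvd_smult_iff)
  hence "P (l + 1) dvd A"
    using pr low[OF irr \<open>P l dvd w\<close>] \<open>\<not> P (l + 1) dvd w\<close>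
    by (simp add: prime_elem_dvd_mult_iff dvd_dilate)
  moreover have "P (l + 1) dvd dilate (Q ^ nat (l - k)) B"
  proof -
    \<comment> \<open>The dilation taking \<open>P k\<close> to \<open>P (l + 1)\<close> takes
      \<open>B(x / Q)\<close> to \<open>B(Q^(l - k) x)\<close>. As \<open>k \<le> l\<close>, the
      exponent is a natural number, as \<open>cop\<close> requires.\<close>
    have "dilate (Q powi (l + 1 - k)) (dilate (inverse Q) B) = dilate (Q powi (l - k)) B"
      using Q(1) by (simp add: dilate_dilate power_int_add power_int_diff mult.assoc)
    also have "Q powi (l - k) = Q ^ nat (l - k)"
      using D(3) by (simp add: k_def l_def power_int_def)
    finally show ?thesis using dilate_dvd[OF B, of "Q powi (l + 1 - k)"] by (simp add: shift)
  qed
  ultimately have "is_unit (P (l + 1))" using cop coprime_common_divisor by blast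
  thus False using irr irreducible_not_unit by blast
qed

section \<open>Lowest terms and monomial denominators\<close>

lemma exists_irreducible_dvd:
  fixes w :: "'a::field poly"
  assumes "degree w > 0"
  shows "\<exists>s. irreducible s \<and> s dvd w"
  using assms
proof (induction "degree w" arbitrary: w rule: less_induct)
  case less
  have w: "w \<noteq> 0" "\<not> w dvd 1" using less.prems is_unit_iff_degree[of w] by fastforce+
  show ?case
  proof (cases "irreducible w")
    case False
    then obtain a c where ac: "w = a * c" "\<not> a dvd 1" "\<not> c dvd 1"
      using w by (auto simp: irreducible_def)
    hence "a \<noteq> 0" "c \<noteq> 0" using w by auto
    hence "degree a > 0" "degree c > 0" using ac by (auto simp: is_unit_iff_degree)
    hence "degree a < degree w" using ac \<open>a \<noteq> 0\<close> \<open>c \<noteq> 0\<close> by (simp add: degree_mult_eq)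
    from less.hyps[OF this \<open>degree a > 0\<close>] show ?thesis using ac(1) by auto
  qed auto
qed

text \<open>A denominator of least degree works: cancelling a common irreducible factor would lower
  its degree.\<close>

lemma fract_lowest_terms:
  fixes f :: "'a::field poly fract"
  obtains u w where "f = Fract u w" "w \<noteq> 0" "\<And>s. irreducible s \<Longrightarrow> s dvd w \<Longrightarrow> \<not> s dvd u"
proof -
  define N where "N = (\<lambda>d. \<exists>u w. f = Fract u w \<and> w \<noteq> 0 \<and> degree w = d)"
  have "\<exists>d. N d" by (cases f rule: Fract_cases) (auto simp: N_def)
  then obtain d where d: "N d" "\<And>e. e < d \<Longrightarrow> \<not> N e" using exists_least_iff[of N] by blast
  then obtain u w where uw: "f = Fract u w" "w \<noteq> 0" "degree w = d" by (auto simp: N_def)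
  have "\<not> s dvd u" if s: "irreducible s" "s dvd w" for s
  proof
    assume "s dvd u"
    then obtain u' w' where u': "u = s * u'" "w = s * w'" using s(2) by (auto elim!: dvdE)
    have "s \<noteq> 0" "w' \<noteq> 0" using u' uw by auto
    moreover have "degree s > 0" using s(1) \<open>s \<noteq> 0\<close> irreducible_not_unit is_unit_iff_degree by blast
    ultimately have "degree w' < d" using uw u' by (simp add: degree_mult_eq flip: uw(3))
    moreover have "f = Fract u' w'" using uw u' \<open>s \<noteq> 0\<close> \<open>w' \<noteq> 0\<close> by (simp add: eq_fract)
    ultimately show False using d(2) \<open>w' \<noteq> 0\<close> by (auto simp: N_def)
  qed
  thus thesis using that uw by blast
qed

text \<open>After the full power of \<open>x\<close>, written \<open>[:- 0, 1:]\<close>, is split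
  off, a nonconstant cofactor would have an irreducible factor vanishing at 0, and \<open>x\<close>
  would still divide it.\<close>

lemma monomial_if_irreducible_divisors_vanish_at_0:
  fixes w :: "'a::field poly"
  assumes "w \<noteq> 0" and "\<And>s. irreducible s \<Longrightarrow> s dvd w \<Longrightarrow> coeff s 0 = 0"
  obtains c e where "c \<noteq> 0" "w = smult c ([:0, 1:] ^ e)"
proof -
  obtain w' where w': "w = [:- 0, 1:] ^ order 0 w * w'" "\<not> [:- 0, 1:] dvd w'"
    using order_decomp[OF assms(1), of 0] by auto
  have "degree w' = 0"
  proof (rule ccontr)
    assume "degree w' \<noteq> 0"
    then obtain s where s: "irreducible s" "s dvd w'" using exists_irreducible_dvd by blast
    hence "s dvd w" by (subst w'(1)) simp
    hence "poly s 0 = 0" using assms(2) s(1) by (simp add: poly_0_coeff_0)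
    hence "[:- 0, 1:] dvd s" by (subst (asm) poly_eq_0_iff_dvd)
    thus False using w'(2) s(2) dvd_trans by blast
  qed
  then obtain c where "w' = [:c:]" by (elim degree_eq_zeroE)
  hence "w = smult c ([:0, 1:] ^ order 0 w)" using w'(1) by simp
  moreover have "c \<noteq> 0" using calculation assms(1) by auto
  ultimately show thesis using that by blast
qed

lemma to_fract_power: "to_fract (f ^ n) = to_fract f ^ n"
  by (induction n) simp_all

lemma Fract_monomial_in_laurent_polys:
  fixes u :: "'a::field poly"
  assumes "c \<noteq> 0"
  shows "Fract u (smult c ([:0, 1:] ^ e)) \<in> laurent_polys"
proof -
  define X where "X = to_fract [:0, 1 :: 'a:]"
  have X: "X \<noteq> 0" by (simp add: X_def)
  \<comment> \<open>Division by \<open>c x^e\<close> lowers every exponent by \<open>e\<close>. On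
    the shifted index set \<open>I\<close> the argument of \<open>nat\<close> is
    nonnegative.\<close>
  define g where "g = (\<lambda>i::int. coeff u (nat (i + int e)) / c)"
  define I where "I = (\<lambda>i. int i - int e) ` {..degree u}"
  have cinv: "to_fract [:z / c:] = to_fract [:z:] / to_fract [:c:]" for z
    using assms by (simp add: field_simps flip: to_fract_mult)
  have "u = (\<Sum>i\<le>degree u. [:coeff u i:] * [:0, 1:] ^ i)"
    by (subst (1) poly_as_sum_of_monoms[symmetric]) (simp add: monom_altdef)
  hence "to_fract u = (\<Sum>i\<le>degree u. to_fract [:coeff u i:] * X ^ i)"
    by (metis (no_types, lifting) sum.cong to_fract_sum to_fract_mult to_fract_power X_def)
  hence "Fract u (smult c ([:0, 1:] ^ e)) =
      (\<Sum>i\<le>degree u. to_fract [:coeff u i:] * X ^ i) / (to_fract [:c:] * X ^ e)"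
    by (simp add: Fract_conv_to_fract X_def flip: to_fract_power to_fract_mult)
  also have "\<dots> = (\<Sum>i\<le>degree u. to_fract [:g (int i - int e):] * X powi (int i - int e))"
    using X by (simp add: sum_divide_distrib g_def cinv power_int_diff)
  also have "\<dots> = (\<Sum>i\<in>I. to_fract [:g i:] * X powi i)"
    unfolding I_def by (subst sum.reindex) (auto simp: inj_on_def)
  finally show ?thesis unfolding laurent_polys_def X_def I_def by blast
qed

lemma q_gosper_solution:
  fixes Q \<alpha> :: "'a::field"
  assumes Q: "Q \<noteq> 0" "\<forall>k::nat. k > 0 \<longrightarrow> Q ^ k \<noteq> 1" and \<alpha>: "\<alpha> \<noteq> 0"
    and b: "b \<noteq> 0" and BC: "B \<noteq> 0" "C \<noteq> 0"
    and cop: "\<And>h. coprime A (dilate (Q ^ h) B)"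
    and rep: "to_fract b / to_fract (dilate Q b) =
                (to_fract A / to_fract B) * (to_fract (dilate Q C) / to_fract C)"
    and eq: "to_fract e = to_fract b * (to_fract [:\<alpha>:] * map_fract (dilate Q) r - r)"
  shows "r * to_fract b * to_fract C / to_fract (dilate (inverse Q) B) \<in> laurent_polys"
proof -
  let ?\<sigma> = "map_fract (dilate Q)"
  let ?B' = "dilate (inverse Q) B"
  define f where "f = r * to_fract b * to_fract C / to_fract ?B'"
  obtain u w where uw: "f = Fract u w" "w \<noteq> 0" "\<And>s. irreducible s \<Longrightarrow> s dvd w \<Longrightarrow> \<not> s dvd u"
    using fract_lowest_terms by blast
  have hom: "inj_ring_hom (dilate Q)" using Q(1) by (rule inj_ring_hom_dilate)
  have \<sigma>_mult: "?\<sigma> (s * t) = ?\<sigma> s * ?\<sigma> t" for s t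
    using inj_ring_hom_map_fract[OF hom] by (simp add: inj_ring_hom_def)
  have nz: "?B' \<noteq> 0" "dilate Q b \<noteq> 0" "dilate Q C \<noteq> 0" "dilate Q w \<noteq> 0"
    using Q(1) BC b uw(2) by (simp_all add: dilate_eq_0_iff)
  have r: "r * to_fract b * to_fract C = to_fract ?B' * f" using nz by (simp add: f_def)
  \<comment> \<open>Applying \<open>?\<sigma>\<close> to \<open>r\<close> turns
    \<open>B(x / Q)\<close> back into \<open>B\<close>; this factor then cancels against the
    denominator in \<open>rep\<close>.\<close>
  have "?\<sigma> r * to_fract (dilate Q b) * to_fract (dilate Q C) = to_fract B * ?\<sigma> f"
    using arg_cong[OF r, of ?\<sigma>] Q(1)
    by (simp only: \<sigma>_mult map_fract_to_fract[OF hom] dilate_inverse_cancel not_False_eq_True)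
  moreover have "to_fract b * (to_fract B * to_fract C) =
      to_fract A * to_fract (dilate Q C) * to_fract (dilate Q b)"
    using rep nz BC by (simp add: field_simps)
  ultimately have "to_fract B * to_fract (dilate Q C) * to_fract (dilate Q b) * (to_fract b * to_fract C * ?\<sigma> r)
      = to_fract B * to_fract (dilate Q C) * to_fract (dilate Q b) * (to_fract A * ?\<sigma> f)"
    by algebra
  hence \<sigma>r: "to_fract b * to_fract C * ?\<sigma> r = to_fract A * ?\<sigma> f" using nz BC by simp
  \<comment> \<open>Multiplying \<open>eq\<close> by \<open>C\<close> eliminates \<open>r\<close>
    and \<open>b\<close> in favour of \<open>f\<close>. So \<open>e * C\<close> takes the place of
    \<open>e\<close> in \<open>q_gosper_denominator\<close>.\<close>
  have "to_fract (e * C) = to_fract [:\<alpha>:] * to_fract A * ?\<sigma> f - to_fract ?B' * f"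
    using \<sigma>r r eq by (simp only: to_fract_mult) algebra
  also have "?\<sigma> f = to_fract (dilate Q u) / to_fract (dilate Q w)"
    unfolding uw(1) map_fract_Fract[OF hom uw(2)] by (rule Fract_conv_to_fract)
  also have "f = to_fract u / to_fract w" using uw by (simp add: Fract_conv_to_fract)
  finally have "to_fract (e * C * w * dilate Q w) =
      to_fract ([:\<alpha>:] * A * dilate Q u * w - ?B' * u * dilate Q w)"
    using uw(2) nz(4) by (simp add: field_simps del: mult_pCons_left mult_pCons_right)
  hence "smult \<alpha> (A * dilate Q u * w) - ?B' * u * dilate Q w = e * C * w * dilate Q w"
    by (simp only: to_fract_eq_iff) simp
  note den = q_gosper_denominator[OF Q \<alpha> uw(2) cop uw(3) this]
  obtain c k where "c \<noteq> 0" "w = smult c ([:0, 1:] ^ k)"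
    using monomial_if_irreducible_divisors_vanish_at_0[OF uw(2) den] by blast
  hence "f \<in> laurent_polys" using uw(1) Fract_monomial_in_laurent_polys by simp
  thus ?thesis by (simp add: f_def)
qed

subsection \<open>Reduction to the coefficients of powers of \<open>y\<close>\<close>

lemma map_fract_dilate_funpow:
  fixes q :: "'a::field"
  assumes "q \<noteq> 0"
  shows "(map_fract (dilate q) ^^ m) r = map_fract (dilate (q ^ m)) r"
proof -
  obtain u w where r: "r = Fract u w" "w \<noteq> 0" by (metis Fract_cases)
  have "(map_fract (dilate q) ^^ m) r = Fract (dilate (q ^ m) u) (dilate (q ^ m) w)"
    using assms r by (induction m)
      (simp_all add: map_fract_Fract inj_ring_hom_dilate dilate_eq_0_iff dilate_dilate)
  thus ?thesis using assms r by (simp add: map_fract_Fract inj_ring_hom_dilate)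
qed

lemma tau_x_funpow_to_fract:
  assumes "q \<noteq> 0"
  shows "(tau_x q ^^ m) (to_fract f) = to_fract (map_poly (map_fract (dilate (q ^ m))) f)"
proof -
  have z: "map_fract (dilate c) 0 = 0" if "c \<noteq> 0" for c :: 'a
    using that by (intro inj_ring_hom_0 inj_ring_hom_map_fract inj_ring_hom_dilate)
  have "(tau_x q ^^ m) (to_fract f) = to_fract ((map_poly (map_fract (dilate q)) ^^ m) f)"
    by (induction m) (simp_all add: tau_x_to_fract[OF assms])
  moreover have "coeff ((map_poly (map_fract (dilate q)) ^^ m) f) i =
      (map_fract (dilate q) ^^ m) (coeff f i)" for i
    by (induction m) (simp_all add: coeff_map_poly z assms)
  ultimately show ?thesis using assms
    by (auto intro!: poly_eqI simp: coeff_map_poly z map_fract_dilate_funpow)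
qed

theorem theorem4p1:
  fixes q :: "'a::field_char_0"
    and a :: "'a poly poly" and b A B C :: "'a poly"
    and m j :: nat and n v :: int
    and p :: "'a poly fract poly"
  assumes "q \<noteq> 0" and "\<forall>k::nat. k > 0 \<longrightarrow> q ^ k \<noteq> 1"
    and "a \<noteq> 0" and "b \<noteq> 0" and "m > 0" and "j > 0"
    and "q_gosper_rep q m (to_fract b / to_fract (dilate (q ^ m) b)) A B C"
    and "emb_xy a / emb_x b =
           emb_const (q powi (- (v * int j))) *
             (tau_x q ^^ m) (int_iter (tau_y q) (- n) (to_fract p)) - to_fract p"
  shows "\<exists>phat \<in> laurent_polys_y.
           to_fract p = emb_x (dilate (q powi (- int m)) B) * to_fract phat / (emb_x b * emb_x C)"
proof -
  define Q where "Q = q ^ m"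
  define c where "c = q powi (- n)"
  define d where "d = q powi (- (v * int j))"
  have nz: "Q \<noteq> 0" "c \<noteq> 0" "d \<noteq> 0" using assms(1) by (simp_all add: Q_def c_def d_def)
  have Q: "\<forall>k::nat. k > 0 \<longrightarrow> Q ^ k \<noteq> 1"
    using assms(2,5) by (simp add: Q_def flip: power_mult)
  have Qinv: "q powi (- int m) = inverse Q" by (simp add: Q_def power_int_minus)
  have rep: "B \<noteq> 0" "C \<noteq> 0" "to_fract b / to_fract (dilate Q b) =
      (to_fract A / to_fract B) * (to_fract (dilate Q C) / to_fract C)"
    "coprime A (dilate (Q ^ h) B)" for h
    using assms(7) by (auto simp: q_gosper_rep_def Q_def mult.commute simp flip: power_mult)
  let ?\<sigma> = "map_fract (dilate Q)"
  have \<sigma>: "inj_ring_hom (dilate Q)" using nz(1) by (rule inj_ring_hom_dilate)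
  have \<sigma>_mult: "?\<sigma> (s * t) = ?\<sigma> s * ?\<sigma> t" for s t
    using inj_ring_hom_map_fract[OF \<sigma>] by (simp add: inj_ring_hom_def)
  have \<sigma>0: "?\<sigma> 0 = 0" by (rule inj_ring_hom_0[OF inj_ring_hom_map_fract[OF \<sigma>]])
  define B' where "B' = dilate (inverse Q) B"
  have B': "B' \<noteq> 0" using rep(1) nz(1) by (simp add: B'_def dilate_eq_0_iff)
  \<comment> \<open>The required formula, solved for the numerator.\<close>
  define phat where "phat = smult (to_fract b * to_fract C / to_fract B') p"
  have "emb_xy a = emb_x b *
      (emb_const d * (tau_x q ^^ m) (int_iter (tau_y q) (- n) (to_fract p)) - to_fract p)"
    using assms(4) by (simp add: d_def flip: assms(8)) (simp add: emb_x_def)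
  also have "(tau_x q ^^ m) (int_iter (tau_y q) (- n) (to_fract p)) =
      to_fract (map_poly ?\<sigma> (dilate (to_fract [:c:]) p))"
    using assms(1) nz
    by (simp add: int_iter_tau_y tau_y_to_fract tau_x_funpow_to_fract Q_def c_def)
  \<comment> \<open>Injectivity of \<open>to_fract\<close> brings the equation from
    \<open>K(x,y)\<close> back to \<open>K(x)[y]\<close>, where coefficients can be
    compared.\<close>
  finally have expanded: "map_poly to_fract a = [:to_fract b:] *
      ([:to_fract [:d:]:] * map_poly ?\<sigma> (dilate (to_fract [:c:]) p) - p)"
    by (simp only: emb_xy_def emb_x_def emb_const_def flip: to_fract_mult to_fract_diff)
      (simp only: to_fract_eq_iff)
  \<comment> \<open>The shift in \<open>y\<close> only scales the coefficient of \<open>y^i\<close>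
    by \<open>c^i\<close>, so the equation splits into independent ones over
    \<open>K(x)\<close>.\<close>
  have coeffs: "to_fract (coeff a i) = to_fract b *
      (to_fract [:d:] * ?\<sigma> (to_fract [:c:] ^ i * coeff p i) - coeff p i)" for i
    using arg_cong[OF expanded, of "\<lambda>h. coeff h i"]
    by (simp add: coeff_map_poly coeff_dilate \<sigma>0)
  have "coeff phat i \<in> laurent_polys" for i
  proof -
    \<comment> \<open>Since \<open>?\<sigma>\<close> fixes constants, \<open>c^i\<close> can be
      pulled out and joined with \<open>d\<close>. This gives the nonzero
      \<open>\<alpha> = d * c ^ i\<close> for \<open>q_gosper_solution\<close>.\<close>
    have const: "dilate Q [:z:] = [:z:]" for z by (simp add: dilate_def)
    have "to_fract [:c:] ^ i = to_fract [:c ^ i:]"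
      by (simp add: poly_const_pow flip: to_fract_power)
    hence "to_fract (coeff a i) = to_fract b *
        (to_fract [:d * c ^ i:] * ?\<sigma> (coeff p i) - coeff p i)"
      using coeffs[of i] by (simp add: \<sigma>_mult map_fract_to_fract[OF \<sigma>] const flip: to_fract_mult mult.assoc)
    from q_gosper_solution[OF nz(1) Q _ assms(4) rep(1,2,4,3) this] nz
    show ?thesis by (simp add: phat_def B'_def mult_ac)
  qed
  hence "phat \<in> laurent_polys_y" by (simp add: laurent_polys_y_def)
  moreover have "to_fract p = emb_x B' * to_fract phat / (emb_x b * emb_x C)"
  proof -
    have "[:to_fract B':] * phat = [:to_fract b:] * [:to_fract C:] * p"
      using B' by (simp add: phat_def mult.commute)
    hence "emb_x B' * to_fract phat = emb_x b * emb_x C * to_fract p"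
      unfolding emb_x_def by (simp only: flip: to_fract_mult)
    thus ?thesis using assms(4) rep(2) by (simp add: emb_x_def)
  qed
  ultimately show ?thesis unfolding Qinv B'_def by blast
qed

end
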